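(* For integers $1\le p\le n$, the expectation $E_{n,p}=\mathbb{E}(Y_{n,p})$ of the size (number of nodes) $Y_{n,p}$ of the spanning tree of $p$ randomly chosen nodes in a random binary search tree of size $n$ is given by $$E_{n,p}=\frac{2p(n+1)^2}{(n+2-p)(n+1-p)}(H_n-H_p)+\frac{2(2p-1)(n+1)}{(n+2-p)(n+1-p)}+3+2p-\frac{2pn}{n+1-p}+\frac{2p(n+1)(-1)^p}{\binom{n}{p}}H_n+\frac{2p(n+1)(-1)^p}{\binom{n}{p}}\sum_{k=1}^{p-1}\frac{(-1)^k}{k}\binom{n}{k},$$ and, for fixed $p\ge 2$, asymptotically as $n\to\infty$ by $$E_{n,p}=2p\log n+2p\gamma-2pH_p+3-2p-\frac{2p}{p-1}+\mathcal{O}\left(\frac{\log n}{n}\right).$$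
   Context: A random binary search tree of size $n$ is the binary search tree obtained by successively inserting the entries of a uniformly random permutation of $\{1,\dots,n\}$ into an initially empty tree (random permutation model). Equivalently: the key at the root is uniformly distributed on $\{1,\dots,n\}$, and, given that the root is $k$, the left subtree (on the keys $1,\dots,k-1$) and the right subtree (on the keys $k+1,\dots,n$) are independent random binary search trees of sizes $k-1$ and $n-k$. Independently of the tree, a set of $p$ nodes is chosen uniformly at random among all $\binom{n}{p}$ sets of $p$ distinct nodes. The spanning tree of the chosen nodes is the smallest connected subgraph (subtree) of the binary search tree, viewed as an undirected tree, which contains all $p$ chosen nodes; its size is its number of nodes, and $Y_{n,p}$ denotes this number. Notation: $H_m=\sum_{k=1}^m\frac1k$, $\gamma$ is the Euler–Mascheroni constant, $\log$ is the natural logarithm. The constant implied by the $\mathcal{O}$-term may depend on $p$. Empty sums are $0$. *)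

theory Defs
  imports
    "HOL-Library.Tree"
    "HOL-Library.Landau_Symbols"
    "HOL-Combinatorics.Multiset_Permutations"
    "HOL-Analysis.Harmonic_Numbers"
    "HOL-Probability.Probability_Mass_Function"
    "Graph_Theory.Digraph_Component"
begin

fun bst_insert :: "'a::linorder \<Rightarrow> 'a tree \<Rightarrow> 'a tree" where
  "bst_insert x \<langle>\<rangle> = \<langle>\<langle>\<rangle>, x, \<langle>\<rangle>\<rangle>"
| "bst_insert x \<langle>l, y, r\<rangle> =
    (if x < y then \<langle>bst_insert x l, y, r\<rangle>
     else if x > y then \<langle>l, y, bst_insert x r\<rangle>
     else \<langle>l, y, r\<rangle>)"

definition bst_of_list :: "'a::linorder list \<Rightarrow> 'a tree" where
  "bst_of_list xs = fold bst_insert xs \<langle>\<rangle>"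

lemma set_tree_bst_insert: "set_tree (bst_insert x t) = insert x (set_tree t)"
  by (induction t) auto

lemma set_tree_bst_of_list: "set_tree (bst_of_list xs) = set xs"
proof -
  have "set_tree (fold bst_insert xs t) = set xs \<union> set_tree t" for t
    by (induction xs arbitrary: t) (auto simp: set_tree_bst_insert)
  then show ?thesis by (simp add: bst_of_list_def)
qed

definition random_bst :: "nat \<Rightarrow> nat tree pmf" where
  "random_bst n = map_pmf bst_of_list (pmf_of_set (permutations_of_set {1..n}))"

text \<open>
  The nodes of a binary search tree are identified with their keys, which are pairwise distinct.
  Every edge is represented by a single arc, from parent to child. This orientation is
  immaterial below, since \<^const>\<open>Digraph_Component.connected\<close> refers to the symmetric closure, so that
  subgraphs correspond exactly to the subgraphs of the underlying undirected tree.
\<close>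

fun tree_arcs :: "'a tree \<Rightarrow> 'a rel" where
  "tree_arcs \<langle>\<rangle> = {}"
| "tree_arcs \<langle>l, x, r\<rangle> =
    {(x, y) | y. \<exists>l' r'. \<langle>l', y, r'\<rangle> \<in> {l, r}} \<union> tree_arcs l \<union> tree_arcs r"

definition tree_graph :: "'a tree \<Rightarrow> ('a, 'a \<times> 'a) pre_digraph" where
  "tree_graph t = with_proj \<lparr> pverts = set_tree t, parcs = tree_arcs t \<rparr>"

definition connects :: "('a, 'b) pre_digraph \<Rightarrow> 'a set \<Rightarrow> ('a, 'b) pre_digraph \<Rightarrow> bool" where
  "connects G S H \<longleftrightarrow> subgraph H G \<and> Digraph_Component.connected H \<and> S \<subseteq> verts H"

definition spanning_tree_size :: "'a tree \<Rightarrow> 'a set \<Rightarrow> nat" where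
  "spanning_tree_size t S =
    (LEAST m. \<exists>H. connects (tree_graph t) S H \<and> card (verts H) = m)"

text \<open>
  The law of $Y_{n,p}$. The set of chosen nodes is drawn independently of the tree, which always
  has the node set \<^term>\<open>{1..n}\<close> by \<open>set_tree_bst_of_list\<close>.
\<close>

definition Y_pmf :: "nat \<Rightarrow> nat \<Rightarrow> nat pmf" where
  "Y_pmf n p = map_pmf (\<lambda>(t, S). spanning_tree_size t S)
    (pair_pmf (random_bst n) (pmf_of_set {S. S \<subseteq> {1..n} \<and> card S = p}))"

definition E :: "nat \<Rightarrow> nat \<Rightarrow> real" where
  "E n p = measure_pmf.expectation (Y_pmf n p) real"

end

theory Submission
  imports
    Defs
    "HOL-Probability.Random_Permutations"
    "HOL-Real_Asymp.Real_Asymp"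
begin

text \<open>
  The spanning tree of a set \<open>S\<close> of nodes consists of the lowest common ancestor of \<open>S\<close> and the
  nodes on the paths from there to the elements of \<open>S\<close>. A node is an ancestor of an element of \<open>S\<close>
  iff its subtree meets \<open>S\<close>, and a common ancestor iff its subtree contains \<open>S\<close>. Hence, with \<open>s\<close>
  ranging over the nonempty subtrees, the size of the spanning tree is
  \<open>1 + (\<Sum>\<^sub>s [s \<inter> S \<noteq> {}] - [S \<subseteq> s])\<close> (\<open>spanning_tree_size_eq_card_spanned\<close>, \<open>card_spanned\<close>).

  Summed over all \<open>S\<close> with \<open>p\<close> elements, the contribution of a subtree depends only on the number
  \<open>m\<close> of its nodes (\<open>sum_spanning_tree_size\<close>). The decomposition at the root gives a recurrence for
  the expected sum of a function of the subtree sizes, whose solution shows that there are on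
  average \<open>2 (n + 1) / ((m + 1) (m + 2))\<close> subtrees with \<open>m\<close> nodes, for \<open>1 \<le> m < n\<close>
  (\<open>expectation_subtree_sum\<close>). Together (\<open>E_eq_sum\<close>):
  \<open>E n p = n - 2 (n + 1) / (n choose p) * (\<Sum>m=1..<n. (((n - m) choose p) + (m choose p)) / ((m + 1) (m + 2)))\<close>.

  The part with \<open>(n - m) choose p\<close> is a convolution and evaluates to harmonic numbers
  (\<open>sum_binomial_diff_over_two_factors\<close>). The part with \<open>m choose p\<close> reduces to the sum of
  \<open>(m choose (p - 1)) / (m + 1)\<close>, which up to sign is \<open>harm n\<close> plus an alternating sum over the
  \<open>n\<close>-th row of binomial coefficients (\<open>sum_binomial_over_two_factors\<close>,
  \<open>harm_plus_alternating_binomial_sum\<close>). This yields the closed form, and the asymptotic expansion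
  is read off from it term by term.
\<close>

section \<open>The spanning tree as a sum over subtrees\<close>

fun subtree_sum :: "('a tree \<Rightarrow> real) \<Rightarrow> 'a tree \<Rightarrow> real" where
  "subtree_sum f \<langle>\<rangle> = 0"
| "subtree_sum f \<langle>l, x, r\<rangle> = f \<langle>l, x, r\<rangle> + subtree_sum f l + subtree_sum f r"

lemma subtree_sum_cong:
  assumes "\<And>s. s \<in> subtrees t \<Longrightarrow> f s = g s"
  shows "subtree_sum f t = subtree_sum g t"
  using assms by (induction t) auto

lemma set_tree_subtree_subset: "s \<in> subtrees t \<Longrightarrow> set_tree s \<subseteq> set_tree t"
  by (induction t) auto

lemma subtree_sum_0: "subtree_sum (\<lambda>_. 0) t = 0"
  by (induction t) auto

lemma subtree_sum_sum: "(\<Sum>i\<in>I. subtree_sum (f i) t) = subtree_sum (\<lambda>s. \<Sum>i\<in>I. f i s) t"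
  by (induction t) (auto simp: sum.distrib)

text \<open>
  These are the nodes on the paths from the root to those elements of \<open>S\<close> that occur in the tree.
\<close>

fun ancestors :: "'a tree \<Rightarrow> 'a set \<Rightarrow> 'a set" where
  "ancestors \<langle>\<rangle> S = {}"
| "ancestors \<langle>l, x, r\<rangle> S =
     (if set_tree \<langle>l, x, r\<rangle> \<inter> S = {} then {} else {x} \<union> ancestors l S \<union> ancestors r S)"

text \<open>
  The node set of the spanning tree. As long as \<open>S\<close> lies in one child subtree, the root is not
  needed to connect it. The recursion stops at the lowest common ancestor of \<open>S\<close>, and from there
  on exactly the nodes at or above elements of \<open>S\<close> are needed.
\<close>

fun spanned :: "'a tree \<Rightarrow> 'a set \<Rightarrow> 'a set" where
  "spanned \<langle>\<rangle> S = {}"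
| "spanned \<langle>l, x, r\<rangle> S =
     (if S \<subseteq> set_tree l then spanned l S else if S \<subseteq> set_tree r then spanned r S
      else ancestors \<langle>l, x, r\<rangle> S)"

lemma ancestors_subset: "ancestors t S \<subseteq> set_tree t"
  by (induction t) auto

lemma spanned_subset: "spanned t S \<subseteq> set_tree t"
proof (induction t)
  case (Node l x r)
  then show ?case using ancestors_subset[of "\<langle>l, x, r\<rangle>" S] by auto
qed simp

lemma subset_ancestors: "set_tree t \<inter> S \<subseteq> ancestors t S"
  by (induction t) auto

lemma subset_spanned: "S \<subseteq> set_tree t \<Longrightarrow> S \<subseteq> spanned t S"
proof (induction t)
  case (Node l x r)
  show ?case
  proof (cases "S \<subseteq> set_tree l \<or> S \<subseteq> set_tree r")
    case True
    then show ?thesis using Node.IH by auto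
  next
    case False
    then have "spanned \<langle>l, x, r\<rangle> S = ancestors \<langle>l, x, r\<rangle> S" by simp
    then show ?thesis using subset_ancestors[of "\<langle>l, x, r\<rangle>" S] Node.prems by blast
  qed
qed simp

lemma card_ancestors:
  assumes "distinct (inorder t)"
  shows "real (card (ancestors t S)) = subtree_sum (\<lambda>s. of_bool (set_tree s \<inter> S \<noteq> {})) t"
  using assms
proof (induction t)
  case (Node l x r)
  show ?case
  proof (cases "set_tree \<langle>l, x, r\<rangle> \<inter> S = {}")
    case True
    then have "subtree_sum (\<lambda>s. of_bool (set_tree s \<inter> S \<noteq> {})) \<langle>l, x, r\<rangle> = subtree_sum (\<lambda>_. 0) \<langle>l, x, r\<rangle>"
      by (intro subtree_sum_cong) (use set_tree_subtree_subset in fastforce)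
    then show ?thesis using True by (simp add: subtree_sum_0)
  next
    case False
    have *: "ancestors l S \<inter> ancestors r S = {}" "x \<notin> ancestors l S" "x \<notin> ancestors r S"
      using Node.prems ancestors_subset[of l S] ancestors_subset[of r S] by auto
    have fin: "finite (ancestors l S)" "finite (ancestors r S)"
      using ancestors_subset finite_set_tree by (metis finite_subset)+
    from False have "ancestors \<langle>l, x, r\<rangle> S = insert x (ancestors l S \<union> ancestors r S)" by simp
    also have "real (card \<dots>) = 1 + real (card (ancestors l S)) + real (card (ancestors r S))"
      using * fin by (simp add: card_Un_disjoint)
    finally show ?thesis using Node False by simp
  qed
qed simp

text \<open>
  The ancestors of \<open>S\<close> number \<open>\<Sum>\<^sub>s [s \<inter> S \<noteq> {}]\<close>, and those strictly above the lowest common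
  ancestor have to be discarded. The nodes at or above it are those whose subtree contains all of
  \<open>S\<close>; the summand \<open>1\<close> restores the lowest common ancestor itself. With this formula the average
  over \<open>S\<close> can be taken subtree by subtree.
\<close>

lemma card_spanned:
  assumes "distinct (inorder t)" "S \<noteq> {}" "S \<subseteq> set_tree t"
  shows "real (card (spanned t S)) =
    1 + subtree_sum (\<lambda>s. of_bool (set_tree s \<inter> S \<noteq> {}) - of_bool (S \<subseteq> set_tree s)) t"
    (is "_ = 1 + subtree_sum ?f t")
  using assms
proof (induction t)
  case (Node l x r)
  have vanish: "subtree_sum ?f s = 0" if "set_tree s \<inter> S = {}" for s
  proof -
    have "?f u = 0" if "u \<in> subtrees s" for u
    proof -
      have "set_tree u \<inter> S = {}"
        using set_tree_subtree_subset[OF that] \<open>set_tree s \<inter> S = {}\<close> by blast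
      then show ?thesis using \<open>S \<noteq> {}\<close> by auto
    qed
    then have "subtree_sum ?f s = subtree_sum (\<lambda>_. 0) s" by (rule subtree_sum_cong)
    then show ?thesis by (simp add: subtree_sum_0)
  qed
  have partial: "subtree_sum ?f s = subtree_sum (\<lambda>s. of_bool (set_tree s \<inter> S \<noteq> {})) s"
    if "\<not> S \<subseteq> set_tree s" for s
  proof (rule subtree_sum_cong)
    fix u assume "u \<in> subtrees s"
    then have "\<not> S \<subseteq> set_tree u" using set_tree_subtree_subset that by blast
    then show "?f u = of_bool (set_tree u \<inter> S \<noteq> {})" by simp
  qed
  have root: "?f \<langle>l, x, r\<rangle> = 0" using Node.prems by auto
  consider "S \<subseteq> set_tree l" | "S \<subseteq> set_tree r" "\<not> S \<subseteq> set_tree l"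
    | "\<not> S \<subseteq> set_tree l" "\<not> S \<subseteq> set_tree r" by blast
  then show ?case
  proof cases
    case 1
    then have "set_tree r \<inter> S = {}" using Node.prems by auto
    then show ?thesis using Node 1 root vanish[of r] by simp
  next
    case 2
    then have "set_tree l \<inter> S = {}" using Node.prems by auto
    then show ?thesis using Node 2 root vanish[of l] by simp
  next
    case 3
    then show ?thesis
      using Node.prems card_ancestors[of "\<langle>l, x, r\<rangle>" S] root partial[of l] partial[of r]
      by auto
  qed
qed simp

lemma root_in_ancestors:
  "v \<in> ancestors \<langle>l, x, r\<rangle> S \<Longrightarrow> x \<in> ancestors \<langle>l, x, r\<rangle> S"
  by (auto split: if_splits)

lemma tree_arcs_subset: "tree_arcs t \<subseteq> set_tree t \<times> set_tree t"
  by (induction t) auto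

lemma root_reaches_ancestors:
  "v \<in> ancestors \<langle>l, x, r\<rangle> S \<Longrightarrow>
   (x, v) \<in> rtrancl_on (ancestors \<langle>l, x, r\<rangle> S) (tree_arcs \<langle>l, x, r\<rangle>)"
proof (induction "\<langle>l, x, r\<rangle>" arbitrary: l x r)
  case (Node l x r)
  let ?A = "ancestors \<langle>l, x, r\<rangle> S" and ?R = "tree_arcs \<langle>l, x, r\<rangle>"
  have x: "x \<in> ?A" using Node.prems by (rule root_in_ancestors)
  have child: "(x, v) \<in> rtrancl_on ?A ?R"
    if t: "t = l \<or> t = r" and v: "v \<in> ancestors t S" for t
  proof (cases t)
    case Leaf
    then show ?thesis using v by simp
  next
    case (Node a y b)
    have "(y, v) \<in> rtrancl_on (ancestors \<langle>a, y, b\<rangle> S) (tree_arcs \<langle>a, y, b\<rangle>)"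
      using Node.hyps t v Node by metis
    moreover have "ancestors t S \<subseteq> ?A" "tree_arcs t \<subseteq> ?R"
      using t x by (auto split: if_splits)
    ultimately have "(y, v) \<in> rtrancl_on ?A ?R"
      using Node by (metis rtrancl_on_mono)
    moreover have "(x, y) \<in> ?R" using t Node by auto
    ultimately show ?thesis using x by (intro converse_rtrancl_on_into_rtrancl_on[of x y])
  qed
  show ?case
    using Node.prems child x by (auto split: if_splits)
qed

text \<open>
  Connectedness is proved through one node, the lowest common ancestor, from which all others are
  reached by arcs directed downwards.
\<close>

lemma spanned_has_apex:
  assumes "S \<noteq> {}" "S \<subseteq> set_tree t"
  shows "\<exists>c\<in>spanned t S. \<forall>v\<in>spanned t S. (c, v) \<in> rtrancl_on (spanned t S) (tree_arcs t)"
  using assms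
proof (induction t)
  case (Node l x r)
  consider t where "t = l \<or> t = r" "S \<subseteq> set_tree t" "spanned \<langle>l, x, r\<rangle> S = spanned t S"
    | "spanned \<langle>l, x, r\<rangle> S = ancestors \<langle>l, x, r\<rangle> S"
    by (metis spanned.simps(2))
  then show ?case
  proof cases
    case (1 t)
    then obtain c where c: "c \<in> spanned t S"
      "\<And>v. v \<in> spanned t S \<Longrightarrow> (c, v) \<in> rtrancl_on (spanned t S) (tree_arcs t)"
      using Node by blast
    have "tree_arcs t \<subseteq> tree_arcs \<langle>l, x, r\<rangle>" using 1(1) by auto
    from rtrancl_on_mono[OF this order_refl c(2)]
    have "\<forall>v\<in>spanned t S. (c, v) \<in> rtrancl_on (spanned t S) (tree_arcs \<langle>l, x, r\<rangle>)"
      by (rule ballI)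
    then show ?thesis unfolding 1(3) using c(1) by (rule bexI)
  next
    case 2
    obtain v where "v \<in> S" "v \<in> set_tree \<langle>l, x, r\<rangle>" using Node.prems by blast
    then have "v \<in> ancestors \<langle>l, x, r\<rangle> S"
      using subset_ancestors[of "\<langle>l, x, r\<rangle>" S] by blast
    then have "x \<in> ancestors \<langle>l, x, r\<rangle> S" by (rule root_in_ancestors)
    moreover have "\<forall>v\<in>ancestors \<langle>l, x, r\<rangle> S.
        (x, v) \<in> rtrancl_on (ancestors \<langle>l, x, r\<rangle> S) (tree_arcs \<langle>l, x, r\<rangle>)"
      by (rule ballI) (rule root_reaches_ancestors)
    ultimately show ?thesis unfolding 2 by (intro bexI)
  qed
qed simp

lemma wf_tree_graph: "wf_digraph (tree_graph t)"
  by (rule wf_digraph.intro) (use tree_arcs_subset[of t] in \<open>auto simp: tree_graph_def\<close>)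

lemma connects_spanned:
  assumes "S \<noteq> {}" "S \<subseteq> set_tree t"
  shows "connects (tree_graph t) S (tree_graph t \<restriction> spanned t S)"
proof -
  let ?G = "tree_graph t" and ?V = "spanned t S"
  interpret wf_digraph ?G by (rule wf_tree_graph)
  have sub: "subgraph (?G \<restriction> ?V) ?G"
    using spanned_subset[of t S] by (intro subgraph_induce_subgraphI) (auto simp: tree_graph_def)
  have arcs: "arcs_ends (?G \<restriction> ?V) = tree_arcs t \<inter> ?V \<times> ?V"
    by (auto simp: arcs_ends_conv tree_graph_def induce_subgraph_def)
  let ?R = "rtrancl_on ?V ((arcs_ends (?G \<restriction> ?V))\<^sup>s)"
  obtain c where c: "c \<in> ?V" "\<And>v. v \<in> ?V \<Longrightarrow> (c, v) \<in> rtrancl_on ?V (tree_arcs t)"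
    using spanned_has_apex[OF assms] by blast
  have down: "(c, v) \<in> ?R" if "v \<in> ?V" for v
    using c(2)[OF that]
  proof (induction rule: rtrancl_on_induct)
    case (step y z)
    then have "(y, z) \<in> (arcs_ends (?G \<restriction> ?V))\<^sup>s" by (auto simp: arcs symcl_def)
    with step show ?case by (meson rtrancl_on_into_rtrancl_on)
  qed simp
  have "sym ?R" by (rule rtrancl_on_sym) (auto simp: sym_def symcl_def)
  then have "(u, v) \<in> ?R" if "u \<in> ?V" "v \<in> ?V" for u v
    using down[OF that(1)] down[OF that(2)] by (meson rtrancl_on_trans symD)
  moreover have "verts (?G \<restriction> ?V) = ?V" by simp
  ultimately have "Digraph_Component.connected (?G \<restriction> ?V)"
    unfolding connected_conv using c(1) by (metis empty_iff)
  moreover have "S \<subseteq> verts (?G \<restriction> ?V)" using subset_spanned[OF assms(2)] by simp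
  ultimately show ?thesis using sub unfolding connects_def by blast
qed

lemma subtree_containing_root:
  assumes "distinct (inorder \<langle>a, y, b\<rangle>)" "s \<in> subtrees \<langle>a, y, b\<rangle>" "y \<in> set_tree s"
  shows "s = \<langle>a, y, b\<rangle>"
proof (rule ccontr)
  assume "s \<noteq> \<langle>a, y, b\<rangle>"
  then have "s \<in> subtrees a \<or> s \<in> subtrees b" using assms(2) by simp
  then have "y \<in> set_tree a \<union> set_tree b" using assms(3) set_tree_subtree_subset by blast
  then show False using assms(1) by auto
qed

text \<open>
  Removing a node separates the tree into its left subtree, its right subtree and the rest. This
  is what forces the nodes of \<^const>\<open>spanned\<close> to belong to every connected subgraph that
  contains \<open>S\<close>.
\<close>

lemma arc_avoiding_node:
  assumes "distinct (inorder t)" "\<langle>l, k, r\<rangle> \<in> subtrees t" "(u, v) \<in> tree_arcs t"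
    and "u \<noteq> k" "v \<noteq> k"
  shows "(u \<in> set_tree l \<longleftrightarrow> v \<in> set_tree l) \<and> (u \<in> set_tree r \<longleftrightarrow> v \<in> set_tree r)"
  using assms
proof (induction t)
  case (Node a x b)
  show ?case
  proof (cases "\<langle>l, k, r\<rangle> = \<langle>a, x, b\<rangle>")
    case True
    then show ?thesis
      using Node.prems tree_arcs_subset[of a] tree_arcs_subset[of b] by auto
  next
    case False
    have main: ?thesis
      if s: "\<langle>l, k, r\<rangle> \<in> subtrees c" and IH: "(u, v) \<in> tree_arcs c \<Longrightarrow> ?thesis"
        and d: "distinct (inorder c)" "x \<notin> set_tree c" "set_tree c \<inter> set_tree d = {}"
        and cd: "c = a \<and> d = b \<or> c = b \<and> d = a" for c d
    proof -
      have sub: "set_tree l \<subseteq> set_tree c" "set_tree r \<subseteq> set_tree c"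
        using set_tree_subtree_subset[OF s] by auto
      consider "(u, v) \<in> tree_arcs c" | "(u, v) \<in> tree_arcs d"
        | "u = x" "\<exists>a' b'. c = \<langle>a', v, b'\<rangle>" | "u = x" "v \<in> set_tree d"
        using Node.prems cd by auto
      then show ?thesis
      proof cases
        case 2
        then have "u \<in> set_tree d" "v \<in> set_tree d" using tree_arcs_subset[of d] by auto
        then have "u \<notin> set_tree c" "v \<notin> set_tree c" using d(3) by auto
        then show ?thesis using sub by blast
      next
        case 3
        \<comment> \<open>The arc leads from the root \<open>x\<close> to the root \<open>v\<close> of \<open>c\<close>. As \<open>v\<close> differs from \<open>k\<close>, the
          subtree at \<open>k\<close> lies strictly below \<open>v\<close> and contains neither end.\<close>
        then obtain a' b' where c: "c = \<langle>a', v, b'\<rangle>" by blast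
        have "v \<notin> set_tree \<langle>l, k, r\<rangle>"
        proof
          assume v: "v \<in> set_tree \<langle>l, k, r\<rangle>"
          have "\<langle>l, k, r\<rangle> = \<langle>a', v, b'\<rangle>"
            by (rule subtree_containing_root[OF d(1)[unfolded c] s[unfolded c] v])
          then show False using \<open>v \<noteq> k\<close> by simp
        qed
        moreover have "u \<notin> set_tree l \<union> set_tree r" using 3 sub d(2) by blast
        ultimately show ?thesis by simp
      next
        case 1
        then show ?thesis by (rule IH)
      next
        case 4
        then have "u \<notin> set_tree c" "v \<notin> set_tree c" using d by auto
        then show ?thesis using sub by blast
      qed
    qed
    from False Node.prems consider "\<langle>l, k, r\<rangle> \<in> subtrees a" | "\<langle>l, k, r\<rangle> \<in> subtrees b" by auto
    then show ?thesis
    proof cases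
      case 1
      then show ?thesis using main[of a b] Node by auto
    next
      case 2
      then show ?thesis using main[of b a] Node by auto
    qed
  qed
qed simp

lemma in_ancestors_subtree:
  "k \<in> ancestors t S \<Longrightarrow> \<exists>l r. \<langle>l, k, r\<rangle> \<in> subtrees t \<and> set_tree \<langle>l, k, r\<rangle> \<inter> S \<noteq> {}"
  by (induction t) (auto split: if_splits)

lemma in_spanned_subtree:
  assumes "k \<in> spanned t S" "S \<subseteq> set_tree t" "distinct (inorder t)"
  shows "\<exists>l r. \<langle>l, k, r\<rangle> \<in> subtrees t \<and> set_tree \<langle>l, k, r\<rangle> \<inter> S \<noteq> {} \<and>
    \<not> S \<subseteq> set_tree l \<and> \<not> S \<subseteq> set_tree r"
  using assms
proof (induction t)
  case (Node a x b)
  show ?case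
  proof (cases "S \<subseteq> set_tree a \<or> S \<subseteq> set_tree b")
    case True
    then obtain c where c: "c = a \<or> c = b" "S \<subseteq> set_tree c" "k \<in> spanned c S"
      using Node.prems(1) by (metis spanned.simps(2))
    have "distinct (inorder c)" using c(1) Node.prems(3) by auto
    then obtain l r where lr: "\<langle>l, k, r\<rangle> \<in> subtrees c" "set_tree \<langle>l, k, r\<rangle> \<inter> S \<noteq> {}"
      "\<not> S \<subseteq> set_tree l" "\<not> S \<subseteq> set_tree r"
      using Node.IH c by blast
    have "\<langle>l, k, r\<rangle> \<in> subtrees \<langle>a, x, b\<rangle>" using c(1) lr(1) by auto
    then show ?thesis using lr by blast
  next
    case False
    then have k: "k \<in> ancestors \<langle>a, x, b\<rangle> S" using Node.prems by simp
    obtain l r where lr: "\<langle>l, k, r\<rangle> \<in> subtrees \<langle>a, x, b\<rangle>" "set_tree \<langle>l, k, r\<rangle> \<inter> S \<noteq> {}"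
      using in_ancestors_subtree[OF k] by blast
    consider "l = a" "r = b" | c where "c = a \<or> c = b" "\<langle>l, k, r\<rangle> \<in> subtrees c"
      using lr(1) by auto
    then have "\<not> S \<subseteq> set_tree l \<and> \<not> S \<subseteq> set_tree r"
    proof cases
      case (2 c)
      have "set_tree l \<subseteq> set_tree c" "set_tree r \<subseteq> set_tree c"
        using set_tree_subtree_subset[OF 2(2)] by auto
      then show ?thesis using False 2(1) by blast
    qed (use False in simp)
    then show ?thesis using lr by blast
  qed
qed simp

lemma rtrancl_on_invariant:
  assumes "(u, v) \<in> rtrancl_on F R" "\<And>a b. (a, b) \<in> R \<Longrightarrow> a \<in> F \<Longrightarrow> b \<in> F \<Longrightarrow> P a = P b"
  shows "P u = P v"
  using assms(1) by (induction rule: rtrancl_on_induct) (use assms(2) in auto)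

text \<open>
  If a connected subgraph avoids a node \<open>k\<close>, it lies on one side of the cut at \<open>k\<close>. For \<open>k\<close> in
  \<^const>\<open>spanned\<close>, no single side contains \<open>S\<close>: some element other than \<open>k\<close> lies in the subtree
  of \<open>k\<close>, and neither child subtree contains all of \<open>S\<close>.
\<close>

lemma spanned_subset_connects:
  assumes "distinct (inorder t)" "S \<noteq> {}" "S \<subseteq> set_tree t" "connects (tree_graph t) S H"
  shows "spanned t S \<subseteq> verts H"
proof
  fix k assume k: "k \<in> spanned t S"
  obtain l r where lr: "\<langle>l, k, r\<rangle> \<in> subtrees t" "set_tree \<langle>l, k, r\<rangle> \<inter> S \<noteq> {}"
    "\<not> S \<subseteq> set_tree l" "\<not> S \<subseteq> set_tree r"
    using in_spanned_subtree[OF k assms(3,1)] by blast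
  have H: "subgraph H (tree_graph t)" "Digraph_Component.connected H" "S \<subseteq> verts H"
    using assms(4) by (auto simp: connects_def)
  have "arcs_ends (tree_graph t) = tree_arcs t" by (auto simp: tree_graph_def arcs_ends_conv)
  with arcs_ends_mono[OF H(1)] have arcs: "arcs_ends H \<subseteq> tree_arcs t" by simp
  show "k \<in> verts H"
  proof (rule ccontr)
    assume k: "k \<notin> verts H"
    have step: "(a \<in> set_tree l) = (b \<in> set_tree l)" "(a \<in> set_tree r) = (b \<in> set_tree r)"
      if "(a, b) \<in> (arcs_ends H)\<^sup>s" "a \<in> verts H" "b \<in> verts H" for a b
      using that arcs k arc_avoiding_node[OF assms(1) lr(1), of a b]
        arc_avoiding_node[OF assms(1) lr(1), of b a]
      by (auto simp: symcl_def)
    have same: "(u \<in> set_tree l) = (v \<in> set_tree l)" "(u \<in> set_tree r) = (v \<in> set_tree r)"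
      if "u \<in> S" "v \<in> S" for u v
    proof -
      have "(u, v) \<in> rtrancl_on (verts H) ((arcs_ends H)\<^sup>s)"
        using H that by (auto simp: connected_conv)
      then show "(u \<in> set_tree l) = (v \<in> set_tree l)" "(u \<in> set_tree r) = (v \<in> set_tree r)"
        by (rule rtrancl_on_invariant; use step in blast)+
    qed
    obtain u where u: "u \<in> S" "u \<in> set_tree l \<or> u \<in> set_tree r" using lr(2) H(3) k by auto
    then show False using same[of u] lr(3,4) by blast
  qed
qed

text \<open>
  The induced subgraph on \<^const>\<open>spanned\<close> attains the minimum, and the cut argument shows that no
  connected subgraph containing \<open>S\<close> has fewer nodes.
\<close>

lemma spanning_tree_size_eq_card_spanned:
  assumes "distinct (inorder t)" "S \<noteq> {}" "S \<subseteq> set_tree t"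
  shows "spanning_tree_size t S = card (spanned t S)"
  unfolding spanning_tree_size_def
proof (rule Least_equality)
  show "\<exists>H. connects (tree_graph t) S H \<and> card (verts H) = card (spanned t S)"
    using connects_spanned[OF assms(2,3)] by (intro exI[of _ "tree_graph t \<restriction> spanned t S"]) simp
next
  fix m assume "\<exists>H. connects (tree_graph t) S H \<and> card (verts H) = m"
  then obtain H where H: "connects (tree_graph t) S H" "card (verts H) = m" by blast
  have "verts H \<subseteq> verts (tree_graph t)" using H(1) by (auto simp: connects_def)
  then have "verts H \<subseteq> set_tree t" by (simp add: tree_graph_def)
  then have "finite (verts H)" using finite_set_tree by (rule finite_subset)
  then show "card (spanned t S) \<le> m"
    using spanned_subset_connects[OF assms H(1)] H(2) card_mono by blast
qed

section \<open>Averaging over the tree and the chosen nodes\<close>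

lemma expectation_pair_pmf:
  fixes f :: "'a \<times> 'b \<Rightarrow> real"
  assumes "finite (set_pmf P)" "finite (set_pmf Q)"
  shows "measure_pmf.expectation (pair_pmf P Q) f =
    measure_pmf.expectation P (\<lambda>x. measure_pmf.expectation Q (\<lambda>y. f (x, y)))"
proof -
  have "pair_pmf P Q = P \<bind> (\<lambda>x. map_pmf (Pair x) Q)"
    by (simp add: pair_pmf_def map_pmf_def)
  then have "measure_pmf.expectation (pair_pmf P Q) f =
      (\<Sum>x\<in>set_pmf P. pmf P x *\<^sub>R measure_pmf.expectation (map_pmf (Pair x) Q) f)"
    using assms by (simp only:) (rule pmf_expectation_bind; simp)
  also have "\<dots> = measure_pmf.expectation P (\<lambda>x. measure_pmf.expectation Q (\<lambda>y. f (x, y)))"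
    using assms by (subst integral_measure_pmf[of "set_pmf P" P]) auto
  finally show ?thesis .
qed

lemma fold_bst_insert_Node:
  "fold bst_insert xs \<langle>l, x, r\<rangle> =
   \<langle>fold bst_insert (filter (\<lambda>y. y < x) xs) l, x, fold bst_insert (filter (\<lambda>y. y > x) xs) r\<rangle>"
  by (induction xs arbitrary: l r) auto

lemma bst_of_list_Cons:
  "bst_of_list (x # xs) =
   \<langle>bst_of_list (filter (\<lambda>y. y < x) xs), x, bst_of_list (filter (\<lambda>y. y > x) xs)\<rangle>"
  by (simp add: bst_of_list_def fold_bst_insert_Node)

lemma bst_bst_insert: "bst t \<Longrightarrow> bst (bst_insert x t)"
  by (induction t) (auto simp: set_tree_bst_insert)

lemma bst_bst_of_list: "bst (bst_of_list xs)"
proof -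
  have "bst t \<Longrightarrow> bst (fold bst_insert xs t)" for t
    by (induction xs arbitrary: t) (auto simp: bst_bst_insert)
  then show ?thesis by (simp add: bst_of_list_def)
qed

lemma distinct_inorder_bst_of_list: "distinct (inorder (bst_of_list xs))"
  using bst_bst_of_list[of xs] by (simp add: bst_iff_sorted_wrt_less strict_sorted_iff)

text \<open>
  The random permutation model on an arbitrary set of keys: the recursion at the root leads to
  subtrees whose keys do not start at \<open>1\<close>.
\<close>

definition random_bst_on :: "'a::linorder set \<Rightarrow> 'a tree pmf" where
  "random_bst_on A = map_pmf bst_of_list (pmf_of_set (permutations_of_set A))"

lemma set_pmf_random_bst_on:
  "finite A \<Longrightarrow> set_pmf (random_bst_on A) = bst_of_list ` permutations_of_set A"
  by (simp add: random_bst_on_def)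

lemma finite_set_pmf_random_bst_on: "finite A \<Longrightarrow> finite (set_pmf (random_bst_on A))"
  by (simp add: set_pmf_random_bst_on)

lemma set_tree_random_bst_on:
  "finite A \<Longrightarrow> t \<in> set_pmf (random_bst_on A) \<Longrightarrow> set_tree t = A"
  by (auto simp: set_pmf_random_bst_on set_tree_bst_of_list permutations_of_set_def)

lemma distinct_inorder_random_bst_on:
  "finite A \<Longrightarrow> t \<in> set_pmf (random_bst_on A) \<Longrightarrow> distinct (inorder t)"
  by (auto simp: set_pmf_random_bst_on distinct_inorder_bst_of_list)

text \<open>
  The first entry of a uniformly random permutation is uniformly distributed and becomes the root.
  The remaining entries are inserted left or right according to their size, and the two
  subsequences of smaller and larger entries are independent uniformly random permutations.
\<close>

lemma random_bst_on_rec: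
  fixes A :: "'a::linorder set"
  assumes "finite A" "A \<noteq> {}"
  shows "random_bst_on A =
    pmf_of_set A \<bind> (\<lambda>x. map_pmf (\<lambda>(l, r). \<langle>l, x, r\<rangle>)
      (pair_pmf (random_bst_on {y\<in>A. y < x}) (random_bst_on {y\<in>A. x < y})))"
proof -
  let ?perms = "\<lambda>A :: 'a set. pmf_of_set (permutations_of_set A)"
  have "random_bst_on A =
      pmf_of_set A \<bind> (\<lambda>x. map_pmf (\<lambda>xs. bst_of_list (x # xs)) (?perms (A - {x})))"
    unfolding random_bst_on_def random_permutation_of_set[OF assms]
    by (simp add: map_bind_pmf map_pmf_def bind_assoc_pmf bind_return_pmf)
  also have "\<dots> = pmf_of_set A \<bind> (\<lambda>x. map_pmf (\<lambda>(l, r). \<langle>l, x, r\<rangle>)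
      (pair_pmf (random_bst_on {y\<in>A. y < x}) (random_bst_on {y\<in>A. x < y})))"
  proof (intro bind_pmf_cong refl)
    fix x assume "x \<in> set_pmf (pmf_of_set A)"
    have split: "{y \<in> A - {x}. y < x} = {y\<in>A. y < x}" "{y \<in> A - {x}. \<not> y < x} = {y\<in>A. x < y}"
      by auto
    have "map_pmf (\<lambda>xs. bst_of_list (x # xs)) (?perms (A - {x})) =
        map_pmf ((\<lambda>(l, r). \<langle>l, x, r\<rangle>) \<circ> map_prod bst_of_list bst_of_list \<circ> partition (\<lambda>y. y < x))
          (?perms (A - {x}))"
    proof (intro map_pmf_cong refl)
      fix xs assume "xs \<in> set_pmf (?perms (A - {x}))"
      then have "xs \<in> permutations_of_set (A - {x})" using assms by simp
      then have "x \<notin> set xs" by (simp add: permutations_of_set_def)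
      then have "filter (\<lambda>y. \<not> y < x) xs = filter (\<lambda>y. x < y) xs"
        by (intro filter_cong) (auto simp: not_less order.order_iff_strict)
      then show "bst_of_list (x # xs) =
          ((\<lambda>(l, r). \<langle>l, x, r\<rangle>) \<circ> map_prod bst_of_list bst_of_list \<circ> partition (\<lambda>y. y < x)) xs"
        by (simp add: bst_of_list_Cons o_def)
    qed
    also have "\<dots> = map_pmf (\<lambda>(l, r). \<langle>l, x, r\<rangle>)
        (map_pmf (map_prod bst_of_list bst_of_list)
          (map_pmf (partition (\<lambda>y. y < x)) (?perms (A - {x}))))"
      by (simp only: pmf.map_comp o_assoc)
    also have "\<dots> = map_pmf (\<lambda>(l, r). \<langle>l, x, r\<rangle>)
      (pair_pmf (random_bst_on {y\<in>A. y < x}) (random_bst_on {y\<in>A. x < y}))"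
      unfolding partition_random_permutations[OF finite_Diff[OF assms(1)]] split
      by (simp add: map_prod_def map_pair random_bst_on_def)
    finally show "map_pmf (\<lambda>xs. bst_of_list (x # xs)) (?perms (A - {x})) =
        map_pmf (\<lambda>(l, r). \<langle>l, x, r\<rangle>)
          (pair_pmf (random_bst_on {y\<in>A. y < x}) (random_bst_on {y\<in>A. x < y}))" .
  qed
  finally show ?thesis .
qed

text \<open>
  This is the solution \<open>e\<close> of the recurrence \<open>e n = g n + (2 / n) * (\<Sum>k<n. e k)\<close>, for \<open>n > 0\<close>, of the
  root decomposition. The weight of \<open>g m\<close> is the expected number of subtrees with \<open>m\<close> nodes: the whole
  tree is the only one with \<open>n\<close> nodes, and there are on average \<open>2 (n + 1) / ((m + 1) (m + 2))\<close>
  with \<open>1 \<le> m < n\<close> nodes.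
\<close>

definition mean_subtree_sum :: "(nat \<Rightarrow> real) \<Rightarrow> nat \<Rightarrow> real" where
  "mean_subtree_sum g n = (if n = 0 then 0 else
     g n + (\<Sum>m=1..<n. 2 * (real n + 1) / ((real m + 1) * (real m + 2)) * g m))"

text \<open>
  The partial sums \<open>s n\<close> of the solution satisfy \<open>s (n + 1) = g n + (n + 2) / n * s n\<close>, so
  \<open>s n / (n (n + 1))\<close> grows by \<open>g n / ((n + 1) (n + 2))\<close> in each step.
\<close>

lemma sum_mean_subtree_sum:
  "(\<Sum>k<n. mean_subtree_sum g k) =
   real n * (real n + 1) * (\<Sum>m=1..<n. g m / ((real m + 1) * (real m + 2)))"
proof (induction n)
  case (Suc n)
  show ?case
  proof (cases "n = 0")
    case True
    then show ?thesis by (simp add: mean_subtree_sum_def)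
  next
    case False
    define s where "s = (\<Sum>m=1..<n. g m / ((real m + 1) * (real m + 2)))"
    have "mean_subtree_sum g n = g n + 2 * (real n + 1) * s"
      using False by (simp add: mean_subtree_sum_def s_def sum_distrib_left)
    then have "(\<Sum>k<Suc n. mean_subtree_sum g k) =
        real n * (real n + 1) * s + (g n + 2 * (real n + 1) * s)"
      using Suc by (simp add: s_def)
    also have "\<dots> = real (Suc n) * (real (Suc n) + 1) * (s + g n / ((real n + 1) * (real n + 2)))"
      by (simp add: divide_simps) (simp add: algebra_simps)
    also have "s + g n / ((real n + 1) * (real n + 2)) =
        (\<Sum>m=1..<Suc n. g m / ((real m + 1) * (real m + 2)))"
      using False by (simp add: s_def)
    finally show ?thesis .
  qed
qed simp

lemma mean_subtree_sum_rec:
  assumes "n > 0"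
  shows "mean_subtree_sum g n = g n + 2 / real n * (\<Sum>k<n. mean_subtree_sum g k)"
  unfolding sum_mean_subtree_sum using assms
  by (simp add: mean_subtree_sum_def sum_distrib_left) (intro sum.cong refl, simp add: algebra_simps)

text \<open>
  The size of the left subtree is uniformly distributed on \<open>{0..<n}\<close>, and so is the size of the
  right subtree. This turns \<open>random_bst_on_rec\<close> into the recurrence of \<^const>\<open>mean_subtree_sum\<close>.
\<close>

lemma expectation_subtree_sum:
  "measure_pmf.expectation (random_bst_on {a..<a + n}) (subtree_sum (\<lambda>s. g (card (set_tree s)))) =
   mean_subtree_sum g n"
proof (induction n arbitrary: a rule: less_induct)
  case (less n)
  let ?f = "subtree_sum (\<lambda>s. g (card (set_tree s)))"
  let ?A = "{a..<a + n}"
  show ?case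
  proof (cases "n = 0")
    case True
    then show ?thesis by (simp add: random_bst_on_def mean_subtree_sum_def bst_of_list_def pmf_of_set_singleton)
  next
    case False
    then have A: "finite ?A" "?A \<noteq> {}" by auto
    define M where "M x = map_pmf (\<lambda>(l, r). \<langle>l, x, r\<rangle>)
      (pair_pmf (random_bst_on {y\<in>?A. y < x}) (random_bst_on {y\<in>?A. x < y}))" for x
    have M: "measure_pmf.expectation (M (a + k)) ?f =
        g n + mean_subtree_sum g k + mean_subtree_sum g (n - Suc k)" if "k < n" for k
    proof -
      define L R where "L = random_bst_on {a..<a + k}"
        and "R = random_bst_on {Suc (a + k)..<Suc (a + k) + (n - Suc k)}"
      have LR: "{y\<in>?A. y < a + k} = {a..<a + k}"
          "{y\<in>?A. a + k < y} = {Suc (a + k)..<Suc (a + k) + (n - Suc k)}"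
        using that by auto
      have fin: "finite (set_pmf L)" "finite (set_pmf R)"
        by (simp_all add: finite_set_pmf_random_bst_on L_def R_def)
      have int: "integrable (measure_pmf L) F" "integrable (measure_pmf R) F"
        for F :: "nat tree \<Rightarrow> real"
        using fin by (simp_all add: integrable_measure_pmf_finite)
      have root: "?f \<langle>l, a + k, r\<rangle> = g n + ?f l + ?f r"
        if lr: "l \<in> set_pmf L" "r \<in> set_pmf R" for l r
      proof -
        have "set_tree l = {a..<a + k}" "set_tree r = {Suc (a + k)..<Suc (a + k) + (n - Suc k)}"
          using lr set_tree_random_bst_on unfolding L_def R_def by blast+
        then have "set_tree \<langle>l, a + k, r\<rangle> = ?A" using \<open>k < n\<close> by auto
        then show ?thesis by (simp only: subtree_sum.simps) simp
      qed
      have "measure_pmf.expectation (M (a + k)) ?f =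
          measure_pmf.expectation L (\<lambda>l. measure_pmf.expectation R (\<lambda>r. ?f \<langle>l, a + k, r\<rangle>))"
        unfolding M_def LR L_def[symmetric] R_def[symmetric]
        by (simp only: integral_map_pmf expectation_pair_pmf[OF fin] prod.case)
      also have "\<dots> = measure_pmf.expectation L (\<lambda>l. measure_pmf.expectation R (\<lambda>r. g n + ?f l + ?f r))"
      proof (rule integral_cong_AE)
        show "AE l in measure_pmf L. measure_pmf.expectation R (\<lambda>r. ?f \<langle>l, a + k, r\<rangle>) =
            measure_pmf.expectation R (\<lambda>r. g n + ?f l + ?f r)"
          unfolding AE_measure_pmf_iff
        proof
          fix l assume "l \<in> set_pmf L"
          then have "AE r in measure_pmf R. ?f \<langle>l, a + k, r\<rangle> = g n + ?f l + ?f r"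
            unfolding AE_measure_pmf_iff using root by blast
          then show "measure_pmf.expectation R (\<lambda>r. ?f \<langle>l, a + k, r\<rangle>) =
              measure_pmf.expectation R (\<lambda>r. g n + ?f l + ?f r)"
            by (intro integral_cong_AE) simp_all
        qed
      qed simp_all
      also have "\<dots> = g n + measure_pmf.expectation L ?f + measure_pmf.expectation R ?f"
        by (simp add: int)
      also have "measure_pmf.expectation L ?f = mean_subtree_sum g k"
        unfolding L_def using that by (rule less)
      also have "measure_pmf.expectation R ?f = mean_subtree_sum g (n - Suc k)"
        unfolding R_def using that by (intro less) simp
      finally show ?thesis .
    qed
    have "measure_pmf.expectation (random_bst_on ?A) ?f =
        measure_pmf.expectation (pmf_of_set ?A \<bind> M) ?f"
      unfolding M_def by (subst random_bst_on_rec[OF A]) simp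
    also have "\<dots> = (\<Sum>x\<in>?A. pmf (pmf_of_set ?A) x *\<^sub>R measure_pmf.expectation (M x) ?f)"
      using A by (intro pmf_expectation_bind) (auto simp: M_def finite_set_pmf_random_bst_on)
    also have "\<dots> = (\<Sum>x\<in>?A. measure_pmf.expectation (M x) ?f / real n)"
      using A by (intro sum.cong) auto
    also have "\<dots> = (\<Sum>k<n. measure_pmf.expectation (M (a + k)) ?f / real n)"
      by (intro sum.reindex_bij_witness[of _ "\<lambda>k. a + k" "\<lambda>x. x - a"]) auto
    also have "\<dots> = (\<Sum>k<n. g n + mean_subtree_sum g k + mean_subtree_sum g (n - Suc k)) / real n"
      unfolding sum_divide_distrib using M by simp
    also have "(\<Sum>k<n. g n + mean_subtree_sum g k + mean_subtree_sum g (n - Suc k)) =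
        real n * g n + 2 * (\<Sum>k<n. mean_subtree_sum g k)"
      using sum.nat_diff_reindex[of "mean_subtree_sum g" n] by (simp add: sum.distrib)
    also have "(real n * g n + 2 * (\<Sum>k<n. mean_subtree_sum g k)) / real n = mean_subtree_sum g n"
      using False by (simp add: mean_subtree_sum_rec add_divide_distrib)
    finally show ?thesis .
  qed
qed

text \<open>
  After interchanging the sums over \<open>S\<close> and over the subtrees, a subtree with \<open>m\<close> nodes is avoided
  by \<open>(n - m) choose p\<close> and contains \<open>m choose p\<close> of the sets \<open>S\<close>. The contribution depends on \<open>m\<close>
  only, so that \<open>expectation_subtree_sum\<close> applies.
\<close>

lemma sum_spanning_tree_size:
  assumes "distinct (inorder t)" "p \<ge> 1"
  defines "n \<equiv> card (set_tree t)"
  shows "(\<Sum>S | S \<subseteq> set_tree t \<and> card S = p. real (spanning_tree_size t S)) =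
    real (n choose p) + subtree_sum (\<lambda>s. real (n choose p)
      - real ((n - card (set_tree s)) choose p) - real (card (set_tree s) choose p)) t"
proof -
  let ?P = "{S. S \<subseteq> set_tree t \<and> card S = p}"
  let ?h = "\<lambda>S s. of_bool (set_tree s \<inter> S \<noteq> {}) - of_bool (S \<subseteq> set_tree s) :: real"
  have card_P: "card ?P = n choose p" by (simp add: n_subsets n_def)
  have fin: "finite ?P" by simp
  have "(\<Sum>S\<in>?P. real (spanning_tree_size t S)) = (\<Sum>S\<in>?P. 1 + subtree_sum (?h S) t)"
  proof (intro sum.cong refl)
    fix S assume "S \<in> ?P"
    then have "S \<noteq> {}" "S \<subseteq> set_tree t" using assms(2) by auto
    then show "real (spanning_tree_size t S) = 1 + subtree_sum (?h S) t"
      using assms(1) by (simp add: spanning_tree_size_eq_card_spanned card_spanned)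
  qed
  also have "\<dots> = real (n choose p) + subtree_sum (\<lambda>s. \<Sum>S\<in>?P. ?h S s) t"
    by (simp add: sum.distrib card_P subtree_sum_sum)
  also have "subtree_sum (\<lambda>s. \<Sum>S\<in>?P. ?h S s) t = subtree_sum (\<lambda>s. real (n choose p)
      - real ((n - card (set_tree s)) choose p) - real (card (set_tree s) choose p)) t"
  proof (rule subtree_sum_cong)
    fix s assume "s \<in> subtrees t"
    then have s: "set_tree s \<subseteq> set_tree t" by (rule set_tree_subtree_subset)
    have "{S\<in>?P. set_tree s \<inter> S = {}} = {S. S \<subseteq> set_tree t - set_tree s \<and> card S = p}" by auto
    then have avoid: "card {S\<in>?P. set_tree s \<inter> S = {}} = (n - card (set_tree s)) choose p"
      using s by (simp add: n_subsets card_Diff_subset n_def)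
    have "{S\<in>?P. S \<subseteq> set_tree s} = {S. S \<subseteq> set_tree s \<and> card S = p}" using s by auto
    then have inside: "card {S\<in>?P. S \<subseteq> set_tree s} = card (set_tree s) choose p"
      by (simp add: n_subsets)
    have "(\<Sum>S\<in>?P. ?h S s) =
        (\<Sum>S\<in>?P. 1 - of_bool (set_tree s \<inter> S = {}) - of_bool (S \<subseteq> set_tree s))"
      by (intro sum.cong) auto
    also have "\<dots> = real (card ?P) - real (card {S\<in>?P. set_tree s \<inter> S = {}}) -
        real (card {S\<in>?P. S \<subseteq> set_tree s})"
      by (simp add: sum_subtractf of_bool_def sum.If_cases[OF fin] Int_def)
    finally show "(\<Sum>S\<in>?P. ?h S s) = real (n choose p)
      - real ((n - card (set_tree s)) choose p) - real (card (set_tree s) choose p)"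
      unfolding avoid inside card_P .
  qed
  finally show ?thesis .
qed

lemma E_eq_mean_subtree_sum:
  assumes "1 \<le> p" "p \<le> n"
  shows "E n p = 1 + mean_subtree_sum
    (\<lambda>m. real (n choose p) - real ((n - m) choose p) - real (m choose p)) n / real (n choose p)"
proof -
  let ?P = "{S. S \<subseteq> {1..n} \<and> card S = p}" and ?T = "random_bst_on {1..<1 + n}"
  let ?g = "\<lambda>m. real (n choose p) - real ((n - m) choose p) - real (m choose p)"
  have range: "{1..n} = {1..<1 + n}" by auto
  then have T: "random_bst n = ?T" by (simp add: random_bst_def random_bst_on_def)
  have card_P: "card ?P = n choose p" by (simp add: n_subsets)
  moreover have "n choose p > 0" using assms by simp
  ultimately have P: "finite ?P" "?P \<noteq> {}" by (metis card.empty card.infinite less_irrefl)+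
  have fin: "finite (set_pmf ?T)" by (simp add: finite_set_pmf_random_bst_on)
  have "E n p = measure_pmf.expectation (pair_pmf ?T (pmf_of_set ?P))
      (\<lambda>(t, S). real (spanning_tree_size t S))"
    unfolding E_def Y_pmf_def T by (simp add: case_prod_unfold)
  also have "\<dots> = measure_pmf.expectation ?T
      (\<lambda>t. measure_pmf.expectation (pmf_of_set ?P) (\<lambda>S. real (spanning_tree_size t S)))"
    using P fin by (subst expectation_pair_pmf) auto
  also have "\<dots> = measure_pmf.expectation ?T
      (\<lambda>t. 1 + subtree_sum (\<lambda>s. ?g (card (set_tree s))) t / real (n choose p))"
  proof (rule integral_cong_AE)
    show "AE t in measure_pmf ?T. measure_pmf.expectation (pmf_of_set ?P) (\<lambda>S. real (spanning_tree_size t S))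
        = 1 + subtree_sum (\<lambda>s. ?g (card (set_tree s))) t / real (n choose p)"
      unfolding AE_measure_pmf_iff
    proof
      fix t assume t: "t \<in> set_pmf ?T"
      have set_t: "set_tree t = {1..n}"
        unfolding range by (rule set_tree_random_bst_on[OF finite_atLeastLessThan t])
      have "distinct (inorder t)"
        by (rule distinct_inorder_random_bst_on[OF finite_atLeastLessThan t])
      from sum_spanning_tree_size[OF this assms(1)]
      have "(\<Sum>S\<in>?P. real (spanning_tree_size t S)) =
          real (n choose p) + subtree_sum (\<lambda>s. ?g (card (set_tree s))) t"
        by (simp add: set_t)
      then show "measure_pmf.expectation (pmf_of_set ?P) (\<lambda>S. real (spanning_tree_size t S))
          = 1 + subtree_sum (\<lambda>s. ?g (card (set_tree s))) t / real (n choose p)"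
        using \<open>n choose p > 0\<close>
        by (simp only: integral_pmf_of_set[OF P(2,1)] card_P add_divide_distrib) simp
    qed
  qed simp_all
  also have "\<dots> = 1 + measure_pmf.expectation ?T (subtree_sum (\<lambda>s. ?g (card (set_tree s)))) / real (n choose p)"
    using fin by (simp add: integrable_measure_pmf_finite)
  also have "measure_pmf.expectation ?T (subtree_sum (\<lambda>s. ?g (card (set_tree s)))) = mean_subtree_sum ?g n"
    by (rule expectation_subtree_sum)
  finally show ?thesis .
qed

text \<open>
  The root contributes nothing, since it meets and contains every \<open>S\<close>. The constant part of the
  remaining summands telescopes to \<open>n - 1\<close>, by
  \<open>1 / ((m + 1) (m + 2)) = 1 / (m + 1) - 1 / (m + 2)\<close>.
\<close>

lemma E_eq_sum:
  assumes "1 \<le> p" "p \<le> n"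
  shows "E n p = real n - 2 * (real n + 1) / real (n choose p) *
    (\<Sum>m=1..<n. (real ((n - m) choose p) + real (m choose p)) / ((real m + 1) * (real m + 2)))"
proof -
  let ?c = "real (n choose p)"
  let ?w = "\<lambda>m. (real m + 1) * (real m + 2)"
  let ?b = "\<lambda>m. real ((n - m) choose p) + real (m choose p)"
  have c: "?c \<noteq> 0" and n: "n > 0" using assms by auto
  have "(\<Sum>m=1..<n. 1 / ?w m) = (\<Sum>m=1..<n. (- 1 / (real (Suc m) + 1)) - (- 1 / (real m + 1)))"
    by (intro sum.cong refl) (simp add: field_simps)
  also have "\<dots> = 1 / 2 - 1 / (real n + 1)"
    using n by (subst sum_Suc_diff') auto
  finally have w: "(\<Sum>m=1..<n. 1 / ?w m) = 1 / 2 - 1 / (real n + 1)" .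
  have "mean_subtree_sum (\<lambda>m. ?c - real ((n - m) choose p) - real (m choose p)) n =
      (\<Sum>m=1..<n. 2 * (real n + 1) * ?c * (1 / ?w m) - 2 * (real n + 1) * (?b m / ?w m))"
    using n assms by (auto simp: mean_subtree_sum_def algebra_simps diff_divide_distrib add_divide_distrib
        intro!: sum.cong)
  also have "\<dots> = 2 * (real n + 1) * ?c * (1 / 2 - 1 / (real n + 1)) -
      2 * (real n + 1) * (\<Sum>m=1..<n. ?b m / ?w m)"
    unfolding sum_subtractf w[symmetric] by (simp only: sum_distrib_left)
  also have "2 * (real n + 1) * ?c * (1 / 2 - 1 / (real n + 1)) = ?c * (real n - 1)"
    by (simp add: field_simps)
  finally show ?thesis
    unfolding E_eq_mean_subtree_sum[OF assms] using c by (simp add: diff_divide_distrib)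
qed

section \<open>Evaluation of the binomial sums\<close>

text \<open>
  Both sides satisfy Pascal's recurrence in \<open>n\<close> and \<open>p\<close>; on the right, the increments of the two
  harmonic numbers cancel by the absorption identity.
\<close>

lemma sum_binomial_diff_over_Suc:
  "(\<Sum>m\<le>n. real ((n - m) choose p) / (real m + 1)) = real (Suc n choose p) * (harm (Suc n) - harm p)"
proof (induction n arbitrary: p)
  case 0
  show ?case by (cases p; cases "p - 1") (auto simp: harm_def)
next
  case (Suc n)
  show ?case
  proof (cases p)
    case 0
    have "(\<Sum>m\<le>Suc n. 1 / (real m + 1)) = harm (Suc (Suc n))"
      unfolding harm_altdef lessThan_Suc_atMost by (intro sum.cong refl) (simp add: field_simps)
    then show ?thesis using 0 by (simp add: harm_def)
  next
    case (Suc q)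
    have "(\<Sum>m\<le>Suc n. real ((Suc n - m) choose p) / (real m + 1)) =
        (\<Sum>m\<le>n. real ((n - m) choose q) / (real m + 1) + real ((n - m) choose p) / (real m + 1))"
      using Suc by (simp add: Suc_diff_le add_divide_distrib)
    also have "\<dots> = real (Suc n choose q) * (harm (Suc n) - harm q)
        + real (Suc n choose p) * (harm (Suc n) - harm p)"
      by (simp add: sum.distrib Suc.IH)
    also have "harm q = harm p - 1 / real p"
      using Suc by (simp add: harm_Suc inverse_eq_divide)
    also have "real (Suc n choose q) * (harm (Suc n) - (harm p - 1 / real p))
        + real (Suc n choose p) * (harm (Suc n) - harm p) =
        real (Suc (Suc n) choose p) * (harm (Suc n) - harm p) + real (Suc n choose q) / real p"
      using Suc by (simp add: algebra_simps)
    also have "real (Suc n choose q) / real p = real (Suc (Suc n) choose p) / real (Suc (Suc n))"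
    proof -
      have "real (Suc (Suc n)) * real (Suc n choose q) = real p * real (Suc (Suc n) choose p)"
        using Suc_times_binomial_eq[of "Suc n" q] Suc by (metis mult.commute of_nat_mult)
      then show ?thesis using Suc by (simp add: divide_simps mult.commute)
    qed
    finally show ?thesis
      by (simp add: harm_Suc[of "Suc n"] algebra_simps divide_inverse del: binomial_Suc_Suc)
  qed
qed

text \<open>
  Partial fractions reduce the sum to \<open>sum_binomial_diff_over_Suc\<close> for \<open>n\<close> and for \<open>n + 1\<close>.
\<close>

lemma sum_binomial_diff_over_two_factors:
  assumes "p \<ge> 1" "n \<ge> 1"
  shows "(\<Sum>m=1..<n. real ((n - m) choose p) / ((real m + 1) * (real m + 2))) =
    real ((n + 1) choose p) * (harm (n + 1) - harm p) - real ((n + 2) choose p) * (harm (n + 2) - harm p)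
    + real ((n + 1) choose p) - real (n choose p) / 2"
proof -
  let ?f = "\<lambda>m. real ((n - m) choose p) / ((real m + 1) * (real m + 2))"
  \<comment> \<open>The term at \<open>m = n\<close> vanishes because \<open>p \<ge> 1\<close>.\<close>
  have "{..n} = insert 0 (insert n {1..<n})" using assms by auto
  then have "(\<Sum>m=1..<n. ?f m) = (\<Sum>m\<le>n. ?f m) - real (n choose p) / 2"
    using assms by simp
  also have "(\<Sum>m\<le>n. ?f m) =
      (\<Sum>m\<le>n. real ((n - m) choose p) / (real m + 1)) - (\<Sum>m\<le>n. real ((n - m) choose p) / (real m + 2))"
    unfolding sum_subtractf[symmetric] by (intro sum.cong refl) (simp add: divide_simps algebra_simps)
  also have "(\<Sum>m\<le>n. real ((n - m) choose p) / (real m + 2)) =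
      (\<Sum>m\<le>Suc n. real ((Suc n - m) choose p) / (real m + 1)) - real (Suc n choose p)"
    by (subst sum.atMost_Suc_shift) (simp add: add.commute)
  finally show ?thesis
    unfolding sum_binomial_diff_over_Suc by simp
qed

lemma binomial_reduce_real:
  "p \<ge> 1 \<Longrightarrow> real p * real (n choose p) = (real n + 1 - real p) * real (n choose (p - 1))"
proof -
  assume "p \<ge> 1"
  then obtain q where q: "p = Suc q" by (cases p) auto
  have "real (Suc n) * real (n choose q) = (real (n choose q) + real (n choose p)) * real p"
    using Suc_times_binomial_eq[of n q] q by (metis binomial_Suc_Suc of_nat_add of_nat_mult)
  then show ?thesis using q by (simp add: algebra_simps)
qed

text \<open>
  The sum on the right is the one that \<open>harm_plus_alternating_binomial_sum\<close> expresses by the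
  alternating sum of the closed form. By the absorption identity, the summands on the two sides
  differ by an increment in \<open>n\<close> of the last term.
\<close>

lemma sum_binomial_over_two_factors:
  assumes "p \<ge> 1"
  shows "(\<Sum>m<n. real (m choose p) / ((real m + 1) * (real m + 2))) =
    real p * (\<Sum>m<n. real (m choose (p - 1)) / (real m + 1)) - (real p + 1) * real (n choose p) / (real n + 1)"
proof (induction n)
  case 0
  then show ?case using assms by simp
next
  case (Suc n)
  define x y where "x = real (n choose p)" and "y = real (n choose (p - 1))"
  have "Suc n choose p = (n choose (p - 1)) + (n choose p)"
    using assms by (metis binomial_Suc_Suc Suc_pred' less_eq_Suc_le One_nat_def)
  then have xy: "real (Suc n choose p) = x + y" by (simp add: x_def y_def)
  have absorb: "real p * x = (real n + 1 - real p) * y"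
    unfolding x_def y_def using assms by (rule binomial_reduce_real)
  have "x / ((real n + 1) * (real n + 2)) =
      real p * y / (real n + 1) + (real p + 1) * x / (real n + 1) - (real p + 1) * (x + y) / (real n + 2)"
    using absorb by (simp add: divide_simps) algebra
  moreover have "real (Suc n) + 1 = real n + 2" by simp
  ultimately show ?case
    unfolding sum.lessThan_Suc Suc xy x_def[symmetric] y_def[symmetric]
    by (simp only: distrib_left times_divide_eq_right)
qed

text \<open>
  Raising \<open>n\<close> by one changes the alternating sum, after absorption of the factor \<open>1 / k\<close>, by a
  partial alternating row sum of binomial coefficients, which is a single binomial coefficient.
  The missing term \<open>k = 0\<close> of that row is supplied by the increment of the harmonic number.
\<close>

lemma harm_plus_alternating_binomial_sum:
  assumes "p \<ge> 1"
  shows "(-1) ^ p * (harm n + (\<Sum>k=1..p - 1. (-1) ^ k / real k * real (n choose k))) =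
    - (\<Sum>m<n. real (m choose (p - 1)) / (real m + 1))"
proof (induction n)
  case 0
  have "(\<Sum>k=1..p - 1. (-1) ^ k / real k * real (0 choose k)) = 0"
    by (intro sum.neutral) auto
  then show ?case by (simp add: harm_def)
next
  case (Suc n)
  let ?s = "\<lambda>n. (\<Sum>k=1..p - 1. (-1) ^ k / real k * real (n choose k))"
  have "?s (Suc n) - ?s n = (\<Sum>k=1..p - 1. (-1) ^ k / real k * real (n choose (k - 1)))"
    unfolding sum_subtractf[symmetric]
  proof (intro sum.cong refl)
    fix k assume "k \<in> {1..p - 1}"
    then obtain j where "k = Suc j" by (cases k) auto
    then show "(-1) ^ k / real k * real (Suc n choose k) - (-1) ^ k / real k * real (n choose k) =
        (-1) ^ k / real k * real (n choose (k - 1))"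
      by (simp add: algebra_simps)
  qed
  also have "\<dots> = (\<Sum>k=1..p - 1. (-1) ^ k * real (Suc n choose k)) / (real n + 1)"
    unfolding sum_divide_distrib
  proof (intro sum.cong refl)
    fix k assume "k \<in> {1..p - 1}"
    then obtain j where k: "k = Suc j" by (cases k) auto
    have "(real n + 1) * real (n choose j) = real (Suc n choose k) * real k"
      using Suc_times_binomial_eq[of n j] k by (metis of_nat_mult of_nat_Suc add.commute)
    then show "(-1) ^ k / real k * real (n choose (k - 1)) = (-1) ^ k * real (Suc n choose k) / (real n + 1)"
      using k by (simp add: divide_simps del: binomial_Suc_Suc) (simp add: algebra_simps del: binomial_Suc_Suc)
  qed
  also have "(\<Sum>k=1..p - 1. (-1) ^ k * real (Suc n choose k)) = (-1) ^ (p - 1) * real (n choose (p - 1)) - 1"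
  proof -
    have "(\<Sum>k\<le>p - 1. (-1) ^ k * real (Suc n choose k)) = (-1) ^ (p - 1) * real (n choose (p - 1))"
      using gbinomial_sum_lower_neg[of "real (Suc n)" "p - 1"] by (simp add: binomial_gbinomial mult.commute)
    moreover have "{..p - 1} = insert 0 {1..p - 1}" by auto
    ultimately show ?thesis by simp
  qed
  finally have "?s (Suc n) = ?s n + ((-1) ^ (p - 1) * real (n choose (p - 1)) - 1) / (real n + 1)"
    by simp
  then have "harm (Suc n) + ?s (Suc n) = harm n + ?s n + (-1) ^ (p - 1) * real (n choose (p - 1)) / (real n + 1)"
    by (simp add: harm_Suc field_simps)
  moreover have "(-1) ^ p * (-1) ^ (p - 1) = (-1 :: real)"
    using assms by (cases p) simp_all
  ultimately show ?case using Suc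
    by (simp add: distrib_left mult.assoc[symmetric])
qed

lemma binomial_add_one_real:
  assumes "p \<le> n"
  shows "real ((n + 1) choose p) = real (n choose p) * (real n + 1) / (real n + 1 - real p)"
proof -
  have "(Suc n - p) * (Suc n choose p) = Suc n * (n choose p)"
    using binomial_absorb_comp[of "Suc n" p] by simp
  then have "real (Suc n - p) * real (Suc n choose p) = real (Suc n) * real (n choose p)"
    by (metis of_nat_mult)
  moreover have "real (Suc n - p) = real n + 1 - real p" using assms by (simp add: of_nat_diff)
  moreover have "real n + 1 - real p \<noteq> 0" using assms by simp
  ultimately show ?thesis by (simp add: field_simps del: binomial_Suc_Suc)
qed

text \<open>
  The field identity behind the closed form, with \<open>N\<close>, \<open>P\<close>, \<open>c\<close>, \<open>D\<close> and \<open>T\<close> in the roles of \<open>n\<close>,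
  \<open>p\<close>, \<open>n choose p\<close>, \<open>harm n - harm p\<close> and the left-hand side of
  \<open>harm_plus_alternating_binomial_sum\<close>; \<open>c1\<close> and \<open>c2\<close> are
  \<open>(n + 1) choose p\<close> and \<open>(n + 2) choose p\<close>.
\<close>

lemma E_closed_form_field:
  fixes N P c D T :: real
  assumes "c \<noteq> 0" "N + 1 \<noteq> 0" "N + 2 \<noteq> 0" "N + 1 - P \<noteq> 0" "N + 2 - P \<noteq> 0"
  defines "c1 \<equiv> c * (N + 1) / (N + 1 - P)"
  defines "c2 \<equiv> c1 * (N + 2) / (N + 2 - P)"
  shows "N - 2 * (N + 1) / c * (c1 * (D + 1 / (N + 1)) - c2 * (D + 1 / (N + 1) + 1 / (N + 2)) + c1 - c / 2
      + (P * - T - (P + 1) * c / (N + 1))) =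
    2 * P * (N + 1)\<^sup>2 / ((N + 2 - P) * (N + 1 - P)) * D
    + 2 * (2 * P - 1) * (N + 1) / ((N + 2 - P) * (N + 1 - P))
    + 3 + 2 * P - 2 * P * N / (N + 1 - P) + 2 * P * (N + 1) / c * T"
proof -
  have 1: "2 * (N + 1) / c * c1 = 2 * (N + 1)\<^sup>2 / (N + 1 - P)"
    using assms(1) by (simp add: c1_def power2_eq_square)
  have 2: "2 * (N + 1) / c * c2 = 2 * (N + 1)\<^sup>2 * (N + 2) / ((N + 1 - P) * (N + 2 - P))"
    using assms(1) by (simp add: c2_def c1_def power2_eq_square)
  have 3: "2 * (N + 1) / c * c = 2 * (N + 1)" using assms(1) by simp
  have 4: "P * (2 * (N + 1) / c) * T = 2 * P * (N + 1) / c * T" by simp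
  have "N - k * (c1 * a - c2 * b + c1 - c / 2 + (P * - T - (P + 1) * c / (N + 1))) =
      N - (k * c1) * a + (k * c2) * b - k * c1 + (k * c) / 2 + P * k * T + (P + 1) * (k * c) / (N + 1)"
    for k a b
    by (simp add: algebra_simps)
  from this[of "2 * (N + 1) / c"]
  have "N - 2 * (N + 1) / c * (c1 * (D + 1 / (N + 1)) - c2 * (D + 1 / (N + 1) + 1 / (N + 2)) + c1 - c / 2
      + (P * - T - (P + 1) * c / (N + 1))) =
    N - (2 * (N + 1) / c * c1) * (D + 1 / (N + 1)) + (2 * (N + 1) / c * c2) * (D + 1 / (N + 1) + 1 / (N + 2))
      - 2 * (N + 1) / c * c1 + (2 * (N + 1) / c * c) / 2 + P * (2 * (N + 1) / c) * T
      + (P + 1) * (2 * (N + 1) / c * c) / (N + 1)" .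
  also have "\<dots> = 2 * P * (N + 1)\<^sup>2 / ((N + 2 - P) * (N + 1 - P)) * D
    + 2 * (2 * P - 1) * (N + 1) / ((N + 2 - P) * (N + 1 - P))
    + 3 + 2 * P - 2 * P * N / (N + 1 - P) + 2 * P * (N + 1) / c * T"
  proof -
    define u where "u = N + 1 - P"
    have P: "P = N + 1 - u" and u: "u \<noteq> 0" "u + 1 \<noteq> 0" and v: "N + 2 - (N + 1 - u) = u + 1"
        "N + 1 - (N + 1 - u) = u"
      using assms by (auto simp: u_def)
    \<comment> \<open>The coefficient of \<open>D\<close>, followed by the terms without \<open>D\<close> and \<open>T\<close>.\<close>
    have D: "- 2 * (N + 1)\<^sup>2 / u + 2 * (N + 1)\<^sup>2 * (N + 2) / (u * (u + 1)) =
        2 * (N + 1 - u) * (N + 1)\<^sup>2 / ((u + 1) * u)"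
      using u by (simp add: divide_simps) algebra
    have R: "N - 2 * (N + 1)\<^sup>2 / u * (1 / (N + 1)) + 2 * (N + 1)\<^sup>2 * (N + 2) / (u * (u + 1)) * (1 / (N + 1) + 1 / (N + 2))
        - 2 * (N + 1)\<^sup>2 / u + 2 * (N + 1) / 2 + (N + 1 - u + 1) * (2 * (N + 1)) / (N + 1) =
        2 * (2 * (N + 1 - u) - 1) * (N + 1) / ((u + 1) * u)
        + 3 + 2 * (N + 1 - u) - 2 * (N + 1 - u) * N / u"
      using u assms(2,3) by (simp add: divide_simps) algebra
    show ?thesis
      unfolding 1 2 3 4 unfolding P v using D R by algebra
  qed
  finally show ?thesis .
qed

lemma E_closed_form:
  assumes "1 \<le> p" "p \<le> n"
  shows "E n p =
          2 * real p * (real n + 1)\<^sup>2 / ((real n + 2 - real p) * (real n + 1 - real p))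
            * (harm n - harm p)
          + 2 * (2 * real p - 1) * (real n + 1)
            / ((real n + 2 - real p) * (real n + 1 - real p))
          + 3 + 2 * real p
          - 2 * real p * real n / (real n + 1 - real p)
          + 2 * real p * (real n + 1) * (-1) ^ p / real (n choose p) * harm n
          + 2 * real p * (real n + 1) * (-1) ^ p / real (n choose p)
            * (\<Sum>k = 1..p - 1. (-1) ^ k / real k * real (n choose k))"
proof -
  define c D S where "c = real (n choose p)" and "D = (harm n - harm p :: real)"
    and "S = (\<Sum>k = 1..p - 1. (-1) ^ k / real k * real (n choose k))"
  define T where "T = (-1) ^ p * (harm n + S)"
  have c1: "real ((n + 1) choose p) = c * (real n + 1) / (real n + 1 - real p)"
    unfolding c_def using assms by (intro binomial_add_one_real)
  have n2: "real (n + 1) + 1 = real n + 2" by simp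
  have "real ((n + 2) choose p) =
      real ((n + 1) choose p) * (real (n + 1) + 1) / (real (n + 1) + 1 - real p)"
    using binomial_add_one_real[of p "n + 1"] assms by (simp add: add.assoc)
  then have c2: "real ((n + 2) choose p) =
      c * (real n + 1) / (real n + 1 - real p) * (real n + 2) / (real n + 2 - real p)"
    unfolding c1 n2 .
  have H: "harm (n + 1) - harm p = D + 1 / (real n + 1)"
      "harm (n + 2) - harm p = D + 1 / (real n + 1) + 1 / (real n + 2)"
    by (simp_all add: D_def harm_Suc inverse_eq_divide numeral_2_eq_2 add.commute)
  \<comment> \<open>The additional term at \<open>m = 0\<close> vanishes because \<open>p \<ge> 1\<close>.\<close>
  have "{..<n} = insert 0 {1..<n}" using assms by auto
  then have "(\<Sum>m=1..<n. real (m choose p) / ((real m + 1) * (real m + 2))) =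
      (\<Sum>m<n. real (m choose p) / ((real m + 1) * (real m + 2)))"
    using assms by simp
  also have "\<dots> = real p * (\<Sum>m<n. real (m choose (p - 1)) / (real m + 1)) - (real p + 1) * c / (real n + 1)"
    using sum_binomial_over_two_factors[OF assms(1), of n] by (simp only: c_def)
  also have "(\<Sum>m<n. real (m choose (p - 1)) / (real m + 1)) = - T"
    using harm_plus_alternating_binomial_sum[OF assms(1), of n] by (simp only: T_def S_def minus_minus)
  finally have A: "(\<Sum>m=1..<n. real (m choose p) / ((real m + 1) * (real m + 2))) =
      real p * - T - (real p + 1) * c / (real n + 1)" .
  have nz: "c \<noteq> 0" "real n + 1 \<noteq> 0" "real n + 2 \<noteq> 0" "real n + 1 - real p \<noteq> 0" "real n + 2 - real p \<noteq> 0"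
    using assms by (auto simp: c_def)
  have T: "x / c * T = x * (-1) ^ p / c * harm n + x * (-1) ^ p / c * S" for x
    by (simp add: T_def algebra_simps add_divide_distrib)
  have "E n p = real n - 2 * (real n + 1) / c *
      ((\<Sum>m=1..<n. real ((n - m) choose p) / ((real m + 1) * (real m + 2)))
        + (\<Sum>m=1..<n. real (m choose p) / ((real m + 1) * (real m + 2))))"
    unfolding E_eq_sum[OF assms] c_def by (simp only: add_divide_distrib sum.distrib)
  also have "(\<Sum>m=1..<n. real ((n - m) choose p) / ((real m + 1) * (real m + 2))) =
      real ((n + 1) choose p) * (D + 1 / (real n + 1))
      - real ((n + 2) choose p) * (D + 1 / (real n + 1) + 1 / (real n + 2))
      + real ((n + 1) choose p) - c / 2"
    using sum_binomial_diff_over_two_factors[of p n] assms by (simp only: H c_def)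
  finally show ?thesis
    unfolding A c1 c2 E_closed_form_field[OF nz] T
    unfolding S_def c_def D_def by (simp only: add.assoc)
qed

section \<open>Asymptotics\<close>

text \<open>
  The bounds for the constant compare the harmonic number with \<open>ln (n + 1)\<close>; replacing this by
  \<open>ln n\<close> costs at most \<open>1 / n\<close>.
\<close>

lemma harm_minus_ln_minus_euler_bigo:
  "(\<lambda>n. harm n - ln (real n) - euler_mascheroni) \<in> O(\<lambda>n. 1 / real n)"
proof (rule bigoI[of _ 1])
  show "\<forall>\<^sub>F n in at_top. norm (harm n - ln (real n) - euler_mascheroni) \<le> 1 * norm (1 / real n)"
    using eventually_ge_at_top[of 1]
  proof eventually_elim
    case (elim n)
    have "1 + 1 / real n = real (Suc n) / real n" using elim by (simp add: field_simps)
    then have "ln (real (Suc n)) - ln (real n) = ln (1 + 1 / real n)"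
      using elim by (simp add: ln_div)
    moreover have "ln (1 + 1 / real n) \<le> 1 / real n" using elim by (intro ln_add_one_self_le_self) auto
    moreover have "0 \<le> ln (1 + 1 / real n)" using elim by simp
    moreover have "euler_mascheroni \<ge> harm n - ln (real (Suc n)) + inverse (real (2 * (n + 1)))"
      "euler_mascheroni \<le> harm n - ln (real (Suc n)) + inverse (real (2 * n))"
      using euler_mascheroni_bounds[OF elim] by auto
    moreover have "inverse (real (2 * (n + 1))) \<ge> 0" "inverse (real (2 * n)) \<le> 1 / real n"
      using elim by (auto simp: field_simps)
    ultimately have "\<bar>harm n - ln (real n) - euler_mascheroni\<bar> \<le> 1 / real n" by linarith
    then show ?case by simp
  qed
qed

lemma harm_bigo_ln: "(\<lambda>n. harm n :: real) \<in> O(\<lambda>n. ln (real n))"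
proof -
  have "(\<lambda>n. (harm n - ln (real n) - euler_mascheroni) + (ln (real n) + euler_mascheroni)) \<in> O(\<lambda>n. ln (real n))"
  proof (rule sum_in_bigo)
    show "(\<lambda>n. harm n - ln (real n) - euler_mascheroni) \<in> O(\<lambda>n. ln (real n))"
      by (rule landau_o.big_trans[OF harm_minus_ln_minus_euler_bigo]) real_asymp
    show "(\<lambda>n. ln (real n) + euler_mascheroni) \<in> O(\<lambda>n. ln (real n))" by real_asymp
  qed
  then show ?thesis by simp
qed

text \<open>
  Each of the \<open>d\<close> quotients of neighbouring binomial coefficients is of order \<open>1 / n\<close>.
\<close>

lemma binomial_quotient_bigo:
  "(\<lambda>n. real (n choose k) / real (n choose (k + d))) \<in> O(\<lambda>n. 1 / real n ^ d)"
proof (induction d)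
  case 0
  have "\<forall>\<^sub>F n in at_top. real (n choose k) / real (n choose k) = 1"
    using eventually_ge_at_top[of k] by eventually_elim simp
  then have "(\<lambda>n. real (n choose k) / real (n choose k)) \<in> O(\<lambda>n. 1)"
    by (intro bigoI[of _ 1]) (auto elim: eventually_mono)
  then show ?case by simp
next
  case (Suc d)
  let ?j = "k + d"
  have step: "real (n choose ?j) / real (n choose Suc ?j) = (real ?j + 1) / (real n - real ?j)" if "n > ?j" for n
    using binomial_reduce_real[of "Suc ?j" n] that by (simp add: divide_simps) (simp add: algebra_simps)
  have "\<forall>\<^sub>F n in at_top. real (n choose k) / real (n choose (k + Suc d)) =
      real (n choose k) / real (n choose ?j) * ((real ?j + 1) / (real n - real ?j))"
    using eventually_gt_at_top[of ?j]
  proof eventually_elim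
    case (elim n)
    then show ?case unfolding step[OF elim, symmetric] by simp
  qed
  moreover have "(\<lambda>n. (real ?j + 1) / (real n - real ?j)) \<in> O(\<lambda>n. 1 / real n)"
    by real_asymp
  from landau_o.big.mult[OF Suc this]
  have "(\<lambda>n. real (n choose k) / real (n choose ?j) * ((real ?j + 1) / (real n - real ?j)))
      \<in> O(\<lambda>n. 1 / real n ^ Suc d)"
    by (simp add: mult.commute)
  ultimately show ?case by (subst landau_o.big.in_cong)
qed

lemma scaled_binomial_quotient_bigo:
  assumes "k + 2 \<le> p"
  shows "(\<lambda>n. (real n + 1) * real (n choose k) / real (n choose p)) \<in> O(\<lambda>n. 1 / real n)"
proof -
  have "(\<lambda>n. real (n choose k) / real (n choose p)) \<in> O(\<lambda>n. 1 / real n ^ (p - k))"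
    using binomial_quotient_bigo[of k "p - k"] assms by simp
  also have "(\<lambda>n. 1 / real n ^ (p - k)) \<in> O(\<lambda>n. 1 / real n ^ 2)"
  proof (rule bigoI[of _ 1])
    show "\<forall>\<^sub>F n in at_top. norm (1 / real n ^ (p - k)) \<le> 1 * norm (1 / real n ^ 2)"
      using eventually_ge_at_top[of 1]
    proof eventually_elim
      case (elim n)
      have "real n ^ 2 \<le> real n ^ (p - k)" using elim assms by (intro power_increasing) auto
      then show ?case using elim by (simp add: divide_simps)
    qed
  qed
  finally have "(\<lambda>n. (real n + 1) * (real (n choose k) / real (n choose p))) \<in> O(\<lambda>n. (real n + 1) * (1 / real n ^ 2))"
    by (rule landau_o.big.mult_left)
  also have "(\<lambda>n. (real n + 1) * (1 / real n ^ 2)) \<in> O(\<lambda>n. 1 / real n)" by real_asymp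
  finally show ?thesis by simp
qed

text \<open>
  In the closed form, each coefficient that depends on \<open>n\<close> differs from its limit by \<open>O(1 / n)\<close>.
  The logarithm in the error term comes from multiplying such differences with \<open>harm n\<close>. In the alternating sum only the top index \<open>k = p - 1\<close> survives, since
  \<open>n choose (p - 1)\<close> divided by \<open>n choose p\<close> decays only like \<open>1 / n\<close>. It contributes the limit
  \<open>- 2 p\<^sup>2 / (p - 1) = - 2 p - 2 p / (p - 1)\<close>.
\<close>

lemma E_asymptotics:
  assumes "p \<ge> 2"
  shows "(\<lambda>n. E n p -
            (2 * real p * ln (real n) + 2 * real p * euler_mascheroni - 2 * real p * harm p
             + 3 - 2 * real p - 2 * real p / (real p - 1)))
          \<in> O(\<lambda>n. ln (real n) / real n)"
proof -
  let ?P = "real p"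
  let ?L = "\<lambda>n. ln (real n) / real n"
  \<comment> \<open>\<open>X\<close> and \<open>Q\<close> are rational coefficients, \<open>Z\<close> is the coefficient of the last harmonic
    number, and \<open>W\<close> is the alternating sum without its top index.\<close>
  define X where "X n = (real n + 1)\<^sup>2 / ((real n + 2 - ?P) * (real n + 1 - ?P))" for n
  define Q where "Q n = (real n + 1) / ((real n + 2 - ?P) * (real n + 1 - ?P))" for n
  define Z where "Z n = (real n + 1) * real (n choose 0) / real (n choose p)" for n
  define W where "W n = (\<Sum>k=1..p - 2. (-1) ^ k / real k * ((real n + 1) * real (n choose k) / real (n choose p)))" for n
  have inv: "(\<lambda>n. 1 / real n) \<in> O(?L)" by real_asymp
  have small: "f \<in> O(\<lambda>n. 1 / real n) \<Longrightarrow> f \<in> O(?L)" for f :: "nat \<Rightarrow> real"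
    by (rule landau_o.big_trans[OF _ inv])
  have X: "(\<lambda>n. X n - 1) \<in> O(\<lambda>n. 1 / real n)" unfolding X_def by real_asymp
  have Q: "Q \<in> O(\<lambda>n. 1 / real n)" unfolding Q_def by real_asymp
  have N: "(\<lambda>n. real n / (real n + 1 - ?P) - 1) \<in> O(\<lambda>n. 1 / real n)" by real_asymp
  have N1: "(\<lambda>n. (real n + 1) / (real n + 1 - ?P) - 1) \<in> O(\<lambda>n. 1 / real n)" by real_asymp
  have Z: "Z \<in> O(\<lambda>n. 1 / real n)"
    unfolding Z_def using assms by (intro scaled_binomial_quotient_bigo) simp
  have W: "W \<in> O(\<lambda>n. 1 / real n)"
    unfolding W_def
    by (intro big_sum_in_bigo landau_o.big.cmult_in_iff[THEN iffD2] disjI2 scaled_binomial_quotient_bigo)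
       (use assms in auto)
  have HX: "(\<lambda>n. (X n - 1) * (harm n - harm p)) \<in> O(?L)"
  proof -
    have "(\<lambda>n. harm n - harm p) \<in> O(\<lambda>n. ln (real n))"
      by (intro sum_in_bigo harm_bigo_ln) real_asymp
    from landau_o.big.mult[OF X this] show ?thesis by simp
  qed
  have HZ: "(\<lambda>n. Z n * harm n) \<in> O(?L)"
    using landau_o.big.mult[OF Z harm_bigo_ln] by simp
  have "(\<lambda>n. 2 * ?P * ((X n - 1) * (harm n - harm p))
      + 2 * ?P * (harm n - ln (real n) - euler_mascheroni)
      + 2 * (2 * ?P - 1) * Q n
      - 2 * ?P * (real n / (real n + 1 - ?P) - 1)
      + 2 * ?P * (-1) ^ p * (Z n * harm n)
      + 2 * ?P * (-1) ^ p * W n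
      - 2 * ?P * ?P / (?P - 1) * ((real n + 1) / (real n + 1 - ?P) - 1)) \<in> O(?L)" (is "?F \<in> _")
    by (intro sum_in_bigo landau_o.big.cmult_in_iff[THEN iffD2] disjI2 HX HZ
        small[OF harm_minus_ln_minus_euler_bigo] small[OF Q] small[OF N] small[OF W] small[OF N1])
      (use assms in auto)
  moreover have "\<forall>\<^sub>F n in at_top. E n p - (2 * ?P * ln (real n) + 2 * ?P * euler_mascheroni - 2 * ?P * harm p
             + 3 - 2 * ?P - 2 * ?P / (?P - 1)) = ?F n"
    using eventually_ge_at_top[of p]
  proof eventually_elim
    case (elim n)
    define c where "c = real (n choose p)"
    have c: "c \<noteq> 0" using elim by (simp add: c_def)
    have u: "real n + 1 - ?P \<noteq> 0" using elim by simp
    have p1: "?P - 1 \<noteq> 0" using assms by simp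
    have "{1..p - 1} = insert (p - 1) {1..p - 2}" "p - 1 \<notin> {1..p - 2}" using assms by auto
    then have top_low: "(\<Sum>k=1..p - 1. (-1) ^ k / real k * real (n choose k)) =
        (-1) ^ (p - 1) / real (p - 1) * real (n choose (p - 1))
          + (\<Sum>k=1..p - 2. (-1) ^ k / real k * real (n choose k))" (is "?S = ?top + ?low")
      using assms by simp
    have "2 * ?P * m * q / c * (t + l) = 2 * ?P * q * (m / c * t) + 2 * ?P * q * (m / c * l)"
      for m q t l
      by (simp add: algebra_simps add_divide_distrib)
    then have S: "2 * ?P * (real n + 1) * (-1) ^ p / c * ?S =
        2 * ?P * (-1) ^ p * ((real n + 1) / c * ?top) + 2 * ?P * (-1) ^ p * ((real n + 1) / c * ?low)"
      unfolding top_low .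
    have low: "(real n + 1) / c * ?low = W n"
      unfolding W_def c_def[symmetric] sum_distrib_left by (intro sum.cong refl) (simp add: mult_ac)
    have "real (n choose (p - 1)) = ?P * c / (real n + 1 - ?P)"
      using binomial_reduce_real[of p n] assms u by (simp add: c_def field_simps)
    then have "(real n + 1) / c * ?top = (-1) ^ (p - 1) * (?P / (?P - 1) * ((real n + 1) / (real n + 1 - ?P)))"
      using c assms by (simp add: of_nat_diff)
    moreover have "(-1) ^ p * (-1) ^ (p - 1) = (-1 :: real)" using assms by (cases p) simp_all
    ultimately have top: "2 * ?P * (-1) ^ p * ((real n + 1) / c * ?top) =
        - 2 * ?P * (?P / (?P - 1) * ((real n + 1) / (real n + 1 - ?P)))"
      by (metis (no_types, opaque_lifting) mult.assoc mult_minus_left mult_minus_right mult_1)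
    have K: "2 * ?P * ?P / (?P - 1) = 2 * ?P + 2 * ?P / (?P - 1)"
      using p1 by (simp add: field_simps)
    have E: "E n p = 2 * ?P * X n * (harm n - harm p) + 2 * (2 * ?P - 1) * Q n + 3 + 2 * ?P
        - 2 * ?P * (real n / (real n + 1 - ?P)) + 2 * ?P * (-1) ^ p * (Z n * harm n)
        + 2 * ?P * (real n + 1) * (-1) ^ p / c * ?S"
      using elim assms by (subst E_closed_form) (simp_all add: X_def Q_def Z_def c_def)
    define a where "a = (real n + 1) / (real n + 1 - ?P)"
    have "2 * ?P * ?P / (?P - 1) * (a - 1) = 2 * ?P * (?P / (?P - 1) * a) - (2 * ?P + 2 * ?P / (?P - 1))"
      by (subst K[symmetric]) (simp add: right_diff_distrib)
    then show ?case
      unfolding E S low top a_def[symmetric] by (simp add: algebra_simps)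
  qed
  ultimately show ?thesis by (subst landau_o.big.in_cong)
qed

theorem lemma1:
  shows
    "(\<forall>n p :: nat. 1 \<le> p \<and> p \<le> n \<longrightarrow>
        E n p =
          2 * real p * (real n + 1)\<^sup>2 / ((real n + 2 - real p) * (real n + 1 - real p))
            * (harm n - harm p)
          + 2 * (2 * real p - 1) * (real n + 1)
            / ((real n + 2 - real p) * (real n + 1 - real p))
          + 3 + 2 * real p
          - 2 * real p * real n / (real n + 1 - real p)
          + 2 * real p * (real n + 1) * (-1) ^ p / real (n choose p) * harm n
          + 2 * real p * (real n + 1) * (-1) ^ p / real (n choose p)
            * (\<Sum>k = 1..p - 1. (-1) ^ k / real k * real (n choose k)))
     \<and> (\<forall>p :: nat. p \<ge> 2 \<longrightarrow>
        (\<lambda>n :: nat. E n p -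
            (2 * real p * ln (real n) + 2 * real p * euler_mascheroni - 2 * real p * harm p
             + 3 - 2 * real p - 2 * real p / (real p - 1)))
          \<in> O[at_top](\<lambda>n. ln (real n) / real n))"
  using E_closed_form E_asymptotics by blast

end
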